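(* Let $(G,\oplus)$ be a finite group generated by $\{g_1,\dots,g_\alpha\}$, where this is a generating set of $G$ of the smallest possible cardinality, and let $L(G)$ be the Cayley table of $G$ with borders removed. Then $\mathrm{scc}(L(G))=\alpha+1$.
   Context: $L(G)$ is the Latin square with rows, columns and symbols indexed by $G$ and entries $(x,y,x\oplus y)$ for $x,y\in G$ (symbol $x\oplus y$ in row $x$, column $y$). A line is a row, a column, or a symbol. A subsquare of a Latin square $L$ is a subset of its entries that is itself a Latin square; it intersects a line $\ell$ if it contains an entry of $\ell$. A chain of $L$ is a sequence of subsquares $\emptyset=S_0\subseteq S_1\subseteq\cdots\subseteq S_\beta=L$ with $S_1$ a single entry. It is connected if for each $1\le i\le\beta$ there is a line $\ell$ intersecting $S_i$ but not $S_{i-1}$ such that $S_i$ is the smallest subsquare of $L$ intersecting $\ell$ and containing all entries of $S_{i-1}$. Its length is $\beta$; $\mathrm{scc}(L)$ is the minimum length of a connected chain of $L$. *)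

theory Defs
  imports "HOL-Algebra.Generated_Groups"
begin

type_synonym ('r, 'c, 's) entries = "('r \<times> 'c \<times> 's) set"

definition rows :: "('r, 'c, 's) entries \<Rightarrow> 'r set" where
  "rows L = {r. \<exists>c s. (r, c, s) \<in> L}"

definition cols :: "('r, 'c, 's) entries \<Rightarrow> 'c set" where
  "cols L = {c. \<exists>r s. (r, c, s) \<in> L}"

definition syms :: "('r, 'c, 's) entries \<Rightarrow> 's set" where
  "syms L = {s. \<exists>r c. (r, c, s) \<in> L}"

text \<open>A Latin square is given by its set of entries (row, column, symbol); its index sets are the
  rows, columns and symbols that actually occur. The empty set is the Latin square of order 0, as
  is needed for chains to start at the empty subsquare.\<close>

definition latin_square :: "('r, 'c, 's) entries \<Rightarrow> bool" where
  "latin_square L \<longleftrightarrow>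
     finite L \<and> card (rows L) = card (cols L) \<and> card (cols L) = card (syms L) \<and>
     (\<forall>r\<in>rows L. \<forall>c\<in>cols L. \<exists>!s. (r, c, s) \<in> L) \<and>
     (\<forall>r\<in>rows L. \<forall>s\<in>syms L. \<exists>!c. (r, c, s) \<in> L) \<and>
     (\<forall>c\<in>cols L. \<forall>s\<in>syms L. \<exists>!r. (r, c, s) \<in> L)"

definition subsquare :: "('r, 'c, 's) entries \<Rightarrow> ('r, 'c, 's) entries \<Rightarrow> bool" where
  "subsquare S L \<longleftrightarrow> S \<subseteq> L \<and> latin_square S"

definition latin_lines :: "('r, 'c, 's) entries \<Rightarrow> ('r, 'c, 's) entries set" where
  "latin_lines L =
     (\<lambda>r. {(r', c, s) \<in> L. r' = r}) ` rows L \<union>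
     (\<lambda>c. {(r, c', s) \<in> L. c' = c}) ` cols L \<union>
     (\<lambda>s. {(r, c, s') \<in> L. s' = s}) ` syms L"

definition intersects :: "('r, 'c, 's) entries \<Rightarrow> ('r, 'c, 's) entries \<Rightarrow> bool" where
  "intersects S l \<longleftrightarrow> S \<inter> l \<noteq> {}"

definition chain_of ::
    "('r, 'c, 's) entries \<Rightarrow> nat \<Rightarrow> (nat \<Rightarrow> ('r, 'c, 's) entries) \<Rightarrow> bool" where
  "chain_of L \<beta> S \<longleftrightarrow>
     \<beta> \<ge> 1 \<and> S 0 = {} \<and> S \<beta> = L \<and> (\<exists>e. S 1 = {e}) \<and>
     (\<forall>i\<le>\<beta>. subsquare (S i) L) \<and> (\<forall>i<\<beta>. S i \<subseteq> S (Suc i))"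

text \<open>``Smallest'' is taken with respect to the number of entries. Subsquares of a Latin square that
  share an entry intersect in a subsquare, and if they also both meet a line, then so does their
  intersection; so whenever \<open>A\<close> is nonempty the smallest subsquare is unique and is the least one
  with respect to inclusion. For empty \<open>A\<close> (the first step of a chain) no least one exists in
  general, and the smallest ones are exactly the single entries of the line.\<close>

definition smallest_subsquare ::
    "('r, 'c, 's) entries \<Rightarrow> ('r, 'c, 's) entries \<Rightarrow> ('r, 'c, 's) entries \<Rightarrow>
     ('r, 'c, 's) entries \<Rightarrow> bool" where
  "smallest_subsquare L l A T \<longleftrightarrow>
     is_arg_min card (\<lambda>T. subsquare T L \<and> intersects T l \<and> A \<subseteq> T) T"

definition connected_chain ::
    "('r, 'c, 's) entries \<Rightarrow> nat \<Rightarrow> (nat \<Rightarrow> ('r, 'c, 's) entries) \<Rightarrow> bool" where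
  "connected_chain L \<beta> S \<longleftrightarrow>
     chain_of L \<beta> S \<and>
     (\<forall>i\<in>{1..\<beta>}. \<exists>l\<in>latin_lines L.
        intersects (S i) l \<and> \<not> intersects (S (i - 1)) l \<and>
        smallest_subsquare L l (S (i - 1)) (S i))"

definition scc :: "('r, 'c, 's) entries \<Rightarrow> nat" where
  "scc L = (LEAST \<beta>. \<exists>S. connected_chain L \<beta> S)"

definition cayley_square :: "('a, 'b) monoid_scheme \<Rightarrow> ('a, 'a, 'a) entries" where
  "cayley_square G = {(x, y, x \<otimes>\<^bsub>G\<^esub> y) | x y. x \<in> carrier G \<and> y \<in> carrier G}"

end

theory Submission
  imports Defs
begin

text \<open>
  The nonempty subsquares of \<open>L(G)\<close> through a fixed entry \<open>(a, b, ab)\<close> are the sets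
  \<open>aH \<times> Hb\<close> for subgroups \<open>H\<close> of \<open>G\<close>, and each line corresponds to one group element \<open>g\<close>
  such that \<open>aH \<times> Hb\<close> meets the line iff \<open>g \<in> H\<close>. Hence a step of a connected chain
  replaces \<open>H\<close> by the subgroup generated by \<open>H\<close> and one further element, starting from the
  trivial subgroup for \<open>S\<^sub>1\<close>. A connected chain of length \<open>\<beta>\<close> thus yields \<open>\<beta> - 1\<close> generators
  of \<open>G\<close>; conversely, adding the elements of a minimum generating set one by one gives a
  connected chain.
\<close>

section \<open>Lines of a Latin square met by a subset of its entries\<close>

lemma intersects_row_iff:
  "S \<subseteq> L \<Longrightarrow> intersects S {(r', c, s) \<in> L. r' = r} \<longleftrightarrow> r \<in> rows S"
  by (auto simp: intersects_def rows_def)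

lemma intersects_col_iff:
  "S \<subseteq> L \<Longrightarrow> intersects S {(r, c', s) \<in> L. c' = c} \<longleftrightarrow> c \<in> cols S"
  by (auto simp: intersects_def cols_def)

lemma intersects_sym_iff:
  "S \<subseteq> L \<Longrightarrow> intersects S {(r, c, s') \<in> L. s' = s} \<longleftrightarrow> s \<in> syms S"
  by (auto simp: intersects_def syms_def)

section \<open>Squares built from cosets of a subgroup\<close>

context group
begin

text \<open>The subsquare with rows \<open>aH\<close> and columns \<open>Hb\<close>.\<close>

definition coset_square :: "'a \<Rightarrow> 'a \<Rightarrow> 'a set \<Rightarrow> ('a, 'a, 'a) entries" where
  "coset_square a b H =
     {(x, y, x \<otimes> y) | x y. x \<in> carrier G \<and> y \<in> carrier G \<and> inv a \<otimes> x \<in> H \<and> y \<otimes> inv b \<in> H}"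

lemma mem_coset_square_iff:
  "(x, y, z) \<in> coset_square a b H \<longleftrightarrow>
     x \<in> carrier G \<and> y \<in> carrier G \<and> inv a \<otimes> x \<in> H \<and> y \<otimes> inv b \<in> H \<and> z = x \<otimes> y"
  by (auto simp: coset_square_def)

lemma mem_cayley_square_iff:
  "(x, y, z) \<in> cayley_square G \<longleftrightarrow> x \<in> carrier G \<and> y \<in> carrier G \<and> z = x \<otimes> y"
  by (auto simp: cayley_square_def)

lemma coset_square_subset: "coset_square a b H \<subseteq> cayley_square G"
  by (auto simp: coset_square_def cayley_square_def)

lemma coset_square_carrier:
  assumes "a \<in> carrier G" "b \<in> carrier G"
  shows "coset_square a b (carrier G) = cayley_square G"
  using assms by (auto simp: coset_square_def cayley_square_def)

lemma coset_square_one: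
  assumes "a \<in> carrier G" "b \<in> carrier G"
  shows "coset_square a b {\<one>} = {(a, b, a \<otimes> b)}"
proof -
  have "inv a \<otimes> x = \<one> \<longleftrightarrow> x = a" if "x \<in> carrier G" for x
    using assms that by (metis inv_closed inv_equality inv_inv l_inv)
  moreover have "y \<otimes> inv b = \<one> \<longleftrightarrow> y = b" if "y \<in> carrier G" for y
    using assms that by (metis inv_closed inv_equality inv_inv r_inv)
  ultimately show ?thesis
    using assms by (auto simp: coset_square_def)
qed

lemma base_entry_mem_coset_square:
  assumes "a \<in> carrier G" "b \<in> carrier G" "subgroup H G"
  shows "(a, b, a \<otimes> b) \<in> coset_square a b H"
  using assms by (simp add: mem_coset_square_iff subgroup.one_closed)

lemma rows_coset_square:
  assumes "a \<in> carrier G" "b \<in> carrier G" "subgroup H G"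
  shows "rows (coset_square a b H) = {x \<in> carrier G. inv a \<otimes> x \<in> H}"
  using assms by (auto simp: rows_def mem_coset_square_iff subgroup.one_closed
      intro!: exI[of _ b])

lemma cols_coset_square:
  assumes "a \<in> carrier G" "b \<in> carrier G" "subgroup H G"
  shows "cols (coset_square a b H) = {y \<in> carrier G. y \<otimes> inv b \<in> H}"
  using assms by (auto simp: cols_def mem_coset_square_iff subgroup.one_closed
      intro!: exI[of _ a])

text \<open>The symbols form \<open>aHb\<close>, because a row \<open>a \<otimes> h\<close> and a
  column \<open>k \<otimes> b\<close> meet in the symbol
  \<open>a \<otimes> (h \<otimes> k) \<otimes> b\<close>.\<close>

lemma syms_coset_square:
  assumes "a \<in> carrier G" "b \<in> carrier G" "subgroup H G"
  shows "syms (coset_square a b H) = {z \<in> carrier G. inv a \<otimes> z \<otimes> inv b \<in> H}"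
proof (intro equalityI subsetI)
  fix z assume "z \<in> syms (coset_square a b H)"
  then obtain x y where xy: "x \<in> carrier G" "y \<in> carrier G" "inv a \<otimes> x \<in> H" "y \<otimes> inv b \<in> H"
    "z = x \<otimes> y" by (auto simp: syms_def mem_coset_square_iff)
  moreover have "inv a \<otimes> z \<otimes> inv b = (inv a \<otimes> x) \<otimes> (y \<otimes> inv b)"
    using xy assms by (simp add: m_assoc)
  ultimately show "z \<in> {z \<in> carrier G. inv a \<otimes> z \<otimes> inv b \<in> H}"
    using assms by (simp add: subgroup.m_closed)
next
  fix z assume "z \<in> {z \<in> carrier G. inv a \<otimes> z \<otimes> inv b \<in> H}"
  then have "z \<in> carrier G" "inv a \<otimes> (z \<otimes> inv b) \<in> H"
    using assms by (auto simp: m_assoc)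
  \<comment> \<open>Column \<open>b\<close> occurs in every coset square of a subgroup, so the
    symbol is sought there; its row is then forced.\<close>
  then have "(z \<otimes> inv b, b, z) \<in> coset_square a b H"
    using assms by (simp add: mem_coset_square_iff m_assoc subgroup.one_closed)
  then show "z \<in> syms (coset_square a b H)"
    by (auto simp: syms_def)
qed

text \<open>Column \<open>b\<close> alone recovers the subgroup, since its rows are the elements
  \<open>a \<otimes> h\<close> with \<open>h \<in> H\<close>. Inclusions between squares with the
  same base entry can therefore be decided among subgroups.\<close>

lemma coset_square_subset_iff:
  assumes "a \<in> carrier G" "b \<in> carrier G" "subgroup H G" "subgroup K G"
  shows "coset_square a b H \<subseteq> coset_square a b K \<longleftrightarrow> H \<subseteq> K"
proof
  assume sub: "coset_square a b H \<subseteq> coset_square a b K"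
  show "H \<subseteq> K"
  proof
    fix h assume h: "h \<in> H"
    then have "h \<in> carrier G" using assms(3) by (rule subgroup.mem_carrier[rotated])
    moreover from this h have "(a \<otimes> h, b, a \<otimes> h \<otimes> b) \<in> coset_square a b H"
      using assms by (simp add: mem_coset_square_iff subgroup.one_closed flip: m_assoc)
    moreover from this sub have "(a \<otimes> h, b, a \<otimes> h \<otimes> b) \<in> coset_square a b K" by blast
    ultimately show "h \<in> K"
      using assms by (simp add: mem_coset_square_iff flip: m_assoc)
  qed
qed (auto simp: coset_square_def)

lemma coset_square_eq_iff:
  assumes "a \<in> carrier G" "b \<in> carrier G" "subgroup H G" "subgroup K G"
  shows "coset_square a b H = coset_square a b K \<longleftrightarrow> H = K"
  using coset_square_subset_iff[OF assms] coset_square_subset_iff[OF assms(1,2,4,3)] by blast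

lemma finite_cayley_square: "finite (carrier G) \<Longrightarrow> finite (cayley_square G)"
  by (rule finite_subset[of _ "carrier G \<times> carrier G \<times> carrier G"])
    (auto simp: cayley_square_def)

text \<open>The index sets \<open>aH\<close>, \<open>Hb\<close> and \<open>aHb\<close> are
  translates of \<open>H\<close>, hence equinumerous. Two coordinates determine the third by
  multiplication or division in \<open>G\<close>, and closure of \<open>H\<close> keeps the result
  inside the right translate.\<close>

lemma latin_square_coset_square:
  assumes fin: "finite (carrier G)"
    and ab: "a \<in> carrier G" "b \<in> carrier G" and H: "subgroup H G"
  shows "latin_square (coset_square a b H)"
  unfolding latin_square_def rows_coset_square[OF ab H] cols_coset_square[OF ab H]
    syms_coset_square[OF ab H]
proof (intro conjI ballI)
  have HG: "h \<in> carrier G" if "h \<in> H" for h using H that by (rule subgroup.mem_carrier)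
  show "finite (coset_square a b H)"
    using finite_cayley_square[OF fin] coset_square_subset by (rule finite_subset[rotated])
  have "bij_betw (\<lambda>x. inv a \<otimes> x) {x \<in> carrier G. inv a \<otimes> x \<in> H} H"
    by (rule bij_betwI[where g = "\<lambda>h. a \<otimes> h"]) (use ab HG in \<open>auto simp flip: m_assoc\<close>)
  moreover have "bij_betw (\<lambda>y. y \<otimes> inv b) {y \<in> carrier G. y \<otimes> inv b \<in> H} H"
    by (rule bij_betwI[where g = "\<lambda>h. h \<otimes> b"]) (use ab HG in \<open>auto simp: m_assoc\<close>)
  moreover have "bij_betw (\<lambda>z. inv a \<otimes> z \<otimes> inv b) {z \<in> carrier G. inv a \<otimes> z \<otimes> inv b \<in> H} H"
  proof (rule bij_betwI[where g = "\<lambda>h. a \<otimes> h \<otimes> b"])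
    have cancel_a: "a \<otimes> (inv a \<otimes> x) = x" "inv a \<otimes> (a \<otimes> x) = x" if "x \<in> carrier G" for x
      using ab that by (simp_all flip: m_assoc)
    show "(\<lambda>h. a \<otimes> h \<otimes> b) \<in> H \<rightarrow> {z \<in> carrier G. inv a \<otimes> z \<otimes> inv b \<in> H}"
      "\<And>x. x \<in> {z \<in> carrier G. inv a \<otimes> z \<otimes> inv b \<in> H} \<Longrightarrow> a \<otimes> (inv a \<otimes> x \<otimes> inv b) \<otimes> b = x"
      "\<And>y. y \<in> H \<Longrightarrow> inv a \<otimes> (a \<otimes> y \<otimes> b) \<otimes> inv b = y"
      using ab HG by (auto simp: m_assoc cancel_a)
  qed auto
  ultimately show
    "card {x \<in> carrier G. inv a \<otimes> x \<in> H} = card {y \<in> carrier G. y \<otimes> inv b \<in> H}"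
    "card {y \<in> carrier G. y \<otimes> inv b \<in> H} = card {z \<in> carrier G. inv a \<otimes> z \<otimes> inv b \<in> H}"
    by (simp_all add: bij_betw_same_card)
next
  fix x y assume "x \<in> {x \<in> carrier G. inv a \<otimes> x \<in> H}" "y \<in> {y \<in> carrier G. y \<otimes> inv b \<in> H}"
  then show "\<exists>!z. (x, y, z) \<in> coset_square a b H" by (simp add: mem_coset_square_iff)
next
  fix x z
  assume "x \<in> {x \<in> carrier G. inv a \<otimes> x \<in> H}" "z \<in> {z \<in> carrier G. inv a \<otimes> z \<otimes> inv b \<in> H}"
  then have x: "x \<in> carrier G" "inv a \<otimes> x \<in> H" and z: "z \<in> carrier G" "inv a \<otimes> z \<otimes> inv b \<in> H"
    by auto
  \<comment> \<open>The only possible column is \<open>inv x \<otimes> z\<close>. It lies in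
    \<open>Hb\<close> because \<open>a\<close> cancels in this quotient of two elements of
    \<open>H\<close>.\<close>
  have "inv (inv a \<otimes> x) \<otimes> (inv a \<otimes> z \<otimes> inv b) \<in> H"
    using x z H by (simp add: subgroup.m_closed subgroup.m_inv_closed)
  moreover have "a \<otimes> (inv a \<otimes> (z \<otimes> inv b)) = z \<otimes> inv b"
    using z ab by (simp flip: m_assoc)
  then have "inv (inv a \<otimes> x) \<otimes> (inv a \<otimes> z \<otimes> inv b) = inv x \<otimes> z \<otimes> inv b"
    using x z ab by (simp add: inv_mult_group m_assoc)
  ultimately have "inv x \<otimes> z \<otimes> inv b \<in> H" by simp
  then have "(x, inv x \<otimes> z, z) \<in> coset_square a b H"
    using x z by (simp add: mem_coset_square_iff flip: m_assoc)
  moreover have "y = inv x \<otimes> z" if "(x, y, z) \<in> coset_square a b H" for y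
    using that x by (auto simp: mem_coset_square_iff simp flip: m_assoc)
  ultimately show "\<exists>!y. (x, y, z) \<in> coset_square a b H" by blast
next
  fix y z
  assume "y \<in> {y \<in> carrier G. y \<otimes> inv b \<in> H}" "z \<in> {z \<in> carrier G. inv a \<otimes> z \<otimes> inv b \<in> H}"
  then have y: "y \<in> carrier G" "y \<otimes> inv b \<in> H" and z: "z \<in> carrier G" "inv a \<otimes> z \<otimes> inv b \<in> H"
    by auto
  \<comment> \<open>The mirror image: \<open>b\<close> cancels, which places the row
    \<open>z \<otimes> inv y\<close> in \<open>aH\<close>.\<close>
  have "(inv a \<otimes> z \<otimes> inv b) \<otimes> inv (y \<otimes> inv b) \<in> H"
    using y z H by (simp add: subgroup.m_closed subgroup.m_inv_closed)
  moreover have "inv b \<otimes> (b \<otimes> inv y) = inv y"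
    using y ab by (simp flip: m_assoc)
  then have "(inv a \<otimes> z \<otimes> inv b) \<otimes> inv (y \<otimes> inv b) = inv a \<otimes> (z \<otimes> inv y)"
    using y z ab by (simp add: inv_mult_group m_assoc)
  ultimately have "inv a \<otimes> (z \<otimes> inv y) \<in> H" by simp
  then have "(z \<otimes> inv y, y, z) \<in> coset_square a b H"
    using y z by (simp add: mem_coset_square_iff m_assoc)
  moreover have "x = z \<otimes> inv y" if "(x, y, z) \<in> coset_square a b H" for x
    using that y by (auto simp: mem_coset_square_iff m_assoc)
  ultimately show "\<exists>!x. (x, y, z) \<in> coset_square a b H" by blast
qed

section \<open>Classification of the subsquares through a given entry\<close>

lemma subsquare_coset_square:
  assumes "finite (carrier G)" "a \<in> carrier G" "b \<in> carrier G" "subgroup H G"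
  shows "subsquare (coset_square a b H) (cayley_square G)"
  using latin_square_coset_square[OF assms] coset_square_subset by (simp add: subsquare_def)

text \<open>Translating the base entry to the identity turns rows, columns and symbols of
  \<open>T\<close> into subsets of \<open>G\<close>. Completing entries in row \<open>a\<close> and
  in column \<open>b\<close> shows that these three subsets coincide; completing further entries
  makes this common set a subgroup.\<close>

lemma subsquare_eq_coset_square:
  assumes T: "subsquare T (cayley_square G)" and e: "(a, b, a \<otimes> b) \<in> T"
  obtains H where "subgroup H G" "T = coset_square a b H"
proof -
  have prod: "x \<in> carrier G" "y \<in> carrier G" "z = x \<otimes> y" if "(x, y, z) \<in> T" for x y z
    using that T by (auto simp: subsquare_def mem_cayley_square_iff)
  have in_rows: "x \<in> rows T" and in_cols: "y \<in> cols T" and in_syms: "z \<in> syms T"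
    if "(x, y, z) \<in> T" for x y z using that by (auto simp: rows_def cols_def syms_def)
  have ab: "a \<in> carrier G" "b \<in> carrier G" using prod[OF e] by auto
  have rc: "(x, y, x \<otimes> y) \<in> T" if "x \<in> rows T" "y \<in> cols T" for x y
    using that T prod unfolding subsquare_def latin_square_def by metis
  have rs: "\<exists>y. (x, y, z) \<in> T" if "x \<in> rows T" "z \<in> syms T" for x z
    using that T unfolding subsquare_def latin_square_def by metis
  have cs: "\<exists>x. (x, y, z) \<in> T" if "y \<in> cols T" "z \<in> syms T" for y z
    using that T unfolding subsquare_def latin_square_def by metis
  define H where "H = {h \<in> carrier G. a \<otimes> h \<in> rows T}"
  \<comment> \<open>Column \<open>b\<close> pairs the row \<open>a \<otimes> h\<close> with the
    symbol \<open>a \<otimes> h \<otimes> b\<close>.\<close>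
  have H_syms: "h \<in> H \<longleftrightarrow> a \<otimes> h \<otimes> b \<in> syms T" if h: "h \<in> carrier G" for h
  proof
    assume "h \<in> H"
    then show "a \<otimes> h \<otimes> b \<in> syms T" using in_syms[OF rc[OF _ in_cols[OF e]]] by (simp add: H_def)
  next
    assume "a \<otimes> h \<otimes> b \<in> syms T"
    then obtain x where x: "(x, b, a \<otimes> h \<otimes> b) \<in> T" using cs in_cols[OF e] by blast
    then have "x = a \<otimes> h" using prod[OF x] ab h by simp
    then show "h \<in> H" using x in_rows h by (auto simp: H_def)
  qed
  \<comment> \<open>Row \<open>a\<close> pairs the column \<open>h \<otimes> b\<close> with that
    same symbol.\<close>
  have H_cols: "h \<in> H \<longleftrightarrow> h \<otimes> b \<in> cols T" if h: "h \<in> carrier G" for h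
  proof
    assume "h \<in> H"
    then obtain y where y: "(a, y, a \<otimes> h \<otimes> b) \<in> T" using rs in_rows[OF e] H_syms h by blast
    then have "y = h \<otimes> b" using prod[OF y] ab h by (simp add: m_assoc)
    then show "h \<otimes> b \<in> cols T" using y in_cols by blast
  next
    assume "h \<otimes> b \<in> cols T"
    then have "(a, h \<otimes> b, a \<otimes> (h \<otimes> b)) \<in> T" using rc in_rows[OF e] by blast
    then show "h \<in> H" using H_syms[OF h] in_syms h ab by (simp add: m_assoc)
  qed
  have "subgroup H G"
  proof (rule subgroupI)
    show "H \<subseteq> carrier G" by (auto simp: H_def)
    show "H \<noteq> {}" using in_rows[OF e] ab by (auto simp: H_def intro!: exI[of _ \<one>])
  next
    fix h assume "h \<in> H"
    then have h: "h \<in> carrier G" "a \<otimes> h \<in> rows T" by (auto simp: H_def)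
    \<comment> \<open>In row \<open>a \<otimes> h\<close> the base symbol stands in column
      \<open>inv h \<otimes> b\<close>, so the inverse is detected by \<open>H_cols\<close>.\<close>
    then obtain y where y: "(a \<otimes> h, y, a \<otimes> b) \<in> T" using rs in_syms[OF e] by blast
    have "b = h \<otimes> y" using prod[OF y] h ab by (simp add: m_assoc)
    then have "inv h \<otimes> b = y" using prod[OF y] h by (simp flip: m_assoc)
    then show "inv h \<in> H" using H_cols[of "inv h"] in_cols[OF y] h by simp
  next
    fix h k assume hk: "h \<in> H" "k \<in> H"
    then have c: "h \<in> carrier G" "k \<in> carrier G" by (auto simp: H_def)
    \<comment> \<open>Crossing the row of \<open>h\<close> with the column of \<open>k\<close>
      produces the symbol of \<open>h \<otimes> k\<close>.\<close>
    then have "(a \<otimes> h, k \<otimes> b, a \<otimes> h \<otimes> (k \<otimes> b)) \<in> T"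
      using hk rc H_cols[of k] by (auto simp: H_def)
    from in_syms[OF this] show "h \<otimes> k \<in> H" using H_syms[of "h \<otimes> k"] c ab by (simp add: m_assoc)
  qed
  moreover have "T = coset_square a b H"
  proof -
    have row: "x \<in> rows T \<longleftrightarrow> inv a \<otimes> x \<in> H" if "x \<in> carrier G" for x
      using that ab by (simp add: H_def flip: m_assoc)
    have col: "y \<in> cols T \<longleftrightarrow> y \<otimes> inv b \<in> H" if "y \<in> carrier G" for y
      using that ab H_cols[of "y \<otimes> inv b"] by (simp add: m_assoc)
    have "(x, y, z) \<in> T \<longleftrightarrow> (x, y, z) \<in> coset_square a b H" for x y z
      using prod[of x y z] in_rows in_cols rc row[of x] col[of y]
      by (auto simp: mem_coset_square_iff)
    then show ?thesis by auto
  qed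
  ultimately show thesis by (rule that)
qed

section \<open>Lines as group elements, and smallest subsquares\<close>

text \<open>Undoing the translation in \<open>aH\<close>, \<open>Hb\<close> or \<open>aHb\<close>
  turns the index of the line into \<open>g\<close>. This element depends only on the line and the
  base entry, so it serves all subgroups at once.\<close>

lemma line_element:
  assumes l: "l \<in> latin_lines (cayley_square G)" and ab: "a \<in> carrier G" "b \<in> carrier G"
  obtains g where "g \<in> carrier G"
    "\<And>H. subgroup H G \<Longrightarrow> intersects (coset_square a b H) l \<longleftrightarrow> g \<in> H"
proof -
  have cayley_lines: "rows (cayley_square G) \<subseteq> carrier G" "cols (cayley_square G) \<subseteq> carrier G"
    "syms (cayley_square G) \<subseteq> carrier G"
    by (auto simp: rows_def cols_def syms_def mem_cayley_square_iff)
  consider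
    (row) r where "r \<in> rows (cayley_square G)" "l = {(r', c, s) \<in> cayley_square G. r' = r}"
  | (col) c where "c \<in> cols (cayley_square G)" "l = {(r, c', s) \<in> cayley_square G. c' = c}"
  | (sym) s where "s \<in> syms (cayley_square G)" "l = {(r, c, s') \<in> cayley_square G. s' = s}"
    using l unfolding latin_lines_def by (elim UnE imageE) iprover+
  then show thesis
  proof cases
    case row
    then show ?thesis using ab cayley_lines
      by (intro that[of "inv a \<otimes> r"])
        (auto simp: intersects_row_iff coset_square_subset rows_coset_square)
  next
    case col
    then show ?thesis using ab cayley_lines
      by (intro that[of "c \<otimes> inv b"])
        (auto simp: intersects_col_iff coset_square_subset cols_coset_square)
  next
    case sym
    then show ?thesis using ab cayley_lines
      by (intro that[of "inv a \<otimes> s \<otimes> inv b"])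
        (auto simp: intersects_sym_iff coset_square_subset syms_coset_square)
  qed
qed

text \<open>Every competing subsquare contains the base entry and so comes from a subgroup
  \<open>K\<close>; it competes exactly when \<open>K\<close> contains \<open>H\<close> and
  \<open>g\<close>. The generated subgroup is the least such \<open>K\<close>.\<close>

lemma smallest_subsquare_coset_square_iff:
  assumes fin: "finite (carrier G)" and ab: "a \<in> carrier G" "b \<in> carrier G"
    and H: "subgroup H G" and g: "g \<in> carrier G"
    and meets: "\<And>K. subgroup K G \<Longrightarrow> intersects (coset_square a b K) l \<longleftrightarrow> g \<in> K"
  shows "smallest_subsquare (cayley_square G) l (coset_square a b H) T \<longleftrightarrow>
         T = coset_square a b (generate G (insert g H))"
proof -
  define M where "M = coset_square a b (generate G (insert g H))"
  let ?P = "\<lambda>T. subsquare T (cayley_square G) \<and> intersects T l \<and> coset_square a b H \<subseteq> T"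
  have sub: "insert g H \<subseteq> carrier G" using g subgroup.subset[OF H] by simp
  then have gen: "subgroup (generate G (insert g H)) G" by (rule generate_is_subgroup)
  have incl: "insert g H \<subseteq> generate G (insert g H)" by (auto intro: generate.incl)
  have PM: "?P M"
    using subsquare_coset_square[OF fin ab gen] meets[OF gen] incl
      coset_square_subset_iff[OF ab H gen] by (simp add: M_def)
  have least: "M \<subseteq> T" if P: "?P T" for T
  proof -
    have "(a, b, a \<otimes> b) \<in> T" using P base_entry_mem_coset_square[OF ab H] by blast
    with P obtain K where K: "subgroup K G" "T = coset_square a b K"
      using subsquare_eq_coset_square by blast
    then have "insert g H \<subseteq> K"
      using P meets[OF K(1)] coset_square_subset_iff[OF ab H K(1)] by simp
    then show ?thesis
      using K generate_subgroup_incl coset_square_subset_iff[OF ab gen K(1)]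
      by (simp add: M_def)
  qed
  have finT: "finite T" if "?P T" for T using that by (simp add: subsquare_def latin_square_def)
  \<comment> \<open>All competitors are finite, so one that is least for inclusion is the unique one
    of minimum cardinality.\<close>
  have "is_arg_min card ?P T \<longleftrightarrow> T = M"
  proof
    assume "is_arg_min card ?P T"
    then have T: "?P T" "\<not> card M < card T" using PM by (auto simp: is_arg_min_def)
    then show "T = M" using card_subset_eq[OF finT least] card_mono[OF finT least] by force
  next
    assume "T = M"
    then show "is_arg_min card ?P T"
      using PM card_mono[OF finT least] by (force simp: is_arg_min_def not_less)
  qed
  then show ?thesis by (simp add: smallest_subsquare_def M_def)
qed

section \<open>Connected chains and generating sets\<close>

text \<open>This lets a chain of successive closures be recorded by a plain set of generators, one
  more per step.\<close>

lemma generate_insert_generate: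
  assumes "insert g B \<subseteq> carrier G"
  shows "generate G (insert g (generate G B)) = generate G (insert g B)"
proof
  have "generate G B \<subseteq> generate G (insert g B)" by (intro mono_generate) auto
  then show "generate G (insert g (generate G B)) \<subseteq> generate G (insert g B)"
    using assms by (intro generate_subgroup_incl generate_is_subgroup) (auto intro: generate.incl)
  show "generate G (insert g B) \<subseteq> generate G (insert g (generate G B))"
    by (intro mono_generate) (auto intro: generate.incl)
qed

text \<open>The first step only fixes the base entry, with trivial subgroup; each later step adds at
  most one generator. This accounts for the offset of one.\<close>

lemma connected_chain_imp_generating_set:
  assumes fin: "finite (carrier G)" and chain: "connected_chain (cayley_square G) \<beta> S"
  obtains B where "B \<subseteq> carrier G" "generate G B = carrier G" "card B + 1 \<le> \<beta>"
proof -
  have \<beta>: "\<beta> \<ge> 1" "S \<beta> = cayley_square G" and S1: "\<exists>e. S 1 = {e}" and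
    sub1: "subsquare (S 1) (cayley_square G)"
    using chain by (auto simp: connected_chain_def chain_of_def)
  from S1 sub1 obtain a b where ab: "a \<in> carrier G" "b \<in> carrier G"
    and S1: "S 1 = {(a, b, a \<otimes> b)}"
    by (auto simp: subsquare_def cayley_square_def)
  \<comment> \<open>The induction starts at \<open>S 1\<close>, which belongs to the empty
    generating set, so \<open>S (Suc i)\<close> needs at most \<open>i\<close> generators.\<close>
  have "\<exists>B. finite B \<and> card B \<le> i \<and> B \<subseteq> carrier G \<and> S (Suc i) = coset_square a b (generate G B)"
    if "Suc i \<le> \<beta>" for i
    using that
  proof (induction i)
    case 0
    show ?case using S1 coset_square_one[OF ab] by (intro exI[of _ "{}"]) (simp add: generate_empty)
  next
    case (Suc i)
    then obtain B where B: "finite B" "card B \<le> i" "B \<subseteq> carrier G"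
      "S (Suc i) = coset_square a b (generate G B)" by auto
    have "Suc (Suc i) \<in> {1..\<beta>}" using Suc.prems by simp
    then obtain l where l: "l \<in> latin_lines (cayley_square G)"
      and small: "smallest_subsquare (cayley_square G) l (S (Suc i)) (S (Suc (Suc i)))"
      using chain unfolding connected_chain_def by (metis diff_Suc_1)
    obtain g where g: "g \<in> carrier G"
      "\<And>H. subgroup H G \<Longrightarrow> intersects (coset_square a b H) l \<longleftrightarrow> g \<in> H"
      using line_element[OF l ab] by blast
    have "S (Suc (Suc i)) = coset_square a b (generate G (insert g B))"
      using small smallest_subsquare_coset_square_iff[OF fin ab generate_is_subgroup[OF B(3)] g]
        B g(1) by (simp add: generate_insert_generate)
    then show ?case
      using B g(1) by (intro exI[of _ "insert g B"]) (simp add: card_insert_if)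
  qed
  from this[of "\<beta> - 1"] \<beta> obtain B where B: "card B \<le> \<beta> - 1" "B \<subseteq> carrier G"
    "cayley_square G = coset_square a b (generate G B)" by auto
  \<comment> \<open>The full square is also the coset square of \<open>carrier G\<close> at the same
    base entry, and the subgroup is determined by the square.\<close>
  then have "generate G B = carrier G"
    using coset_square_carrier[OF ab] coset_square_eq_iff[OF ab generate_is_subgroup subgroup_self]
    by metis
  then show thesis using B \<beta> by (intro that[of B]) auto
qed

text \<open>The chain consists of the coset squares at the identity of the subgroups generated by
  the prefixes of \<open>xs\<close>. Irredundance says that the line chosen for the next generator
  is not yet met.\<close>

lemma connected_chain_of_irredundant_generators:
  assumes fin: "finite (carrier G)" and xs: "set xs \<subseteq> carrier G" "generate G (set xs) = carrier G"
    and irr: "\<And>i. i < length xs \<Longrightarrow> xs ! i \<notin> generate G (set (take i xs))"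
  shows "\<exists>S. connected_chain (cayley_square G) (length xs + 1) S"
proof -
  define H where "H i = generate G (set (take i xs))" for i
  \<comment> \<open>The index is shifted by one to make room for the empty subsquare;
    \<open>S 1\<close> comes from the empty prefix.\<close>
  define S where "S i = (case i of 0 \<Rightarrow> {} | Suc j \<Rightarrow> coset_square \<one> \<one> (H j))" for i
  have S0: "S 0 = {}" and S_Suc: "S (Suc j) = coset_square \<one> \<one> (H j)" for j
    by (simp_all add: S_def)
  have take_carrier: "set (take i xs) \<subseteq> carrier G" for i
    using xs(1) set_take_subset by fast
  have H: "subgroup (H i) G" for i
    unfolding H_def using take_carrier by (rule generate_is_subgroup)
  have S1: "S (Suc 0) = {(\<one>, \<one>, \<one>)}"
    using coset_square_one[of \<one> \<one>] by (simp add: S_Suc H_def generate_empty)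
  have mono: "H i \<subseteq> H (Suc i)" for i
    unfolding H_def by (intro mono_generate set_take_subset_set_take) simp
  have "chain_of (cayley_square G) (length xs + 1) S"
    unfolding chain_of_def
  proof (intro conjI allI impI)
    show "S (length xs + 1) = cayley_square G"
      using xs(2) by (simp add: S_Suc H_def coset_square_carrier)
    show "subsquare (S i) (cayley_square G)" for i
    proof (cases i)
      case 0
      then show ?thesis
        by (simp add: S0 subsquare_def latin_square_def rows_def cols_def syms_def)
    qed (simp add: S_Suc subsquare_coset_square[OF fin] H)
    show "S i \<subseteq> S (Suc i)" for i
      by (cases i) (auto simp: S0 S_Suc coset_square_subset_iff H mono[THEN subsetD])
  qed (use S0 S1 in auto)
  moreover have "\<exists>l\<in>latin_lines (cayley_square G). intersects (S i) l \<and>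
      \<not> intersects (S (i - 1)) l \<and> smallest_subsquare (cayley_square G) l (S (i - 1)) (S i)"
    if i: "i \<in> {1..length xs + 1}" for i
  proof -
    \<comment> \<open>At the base entry of the identity, the row indexed by \<open>r\<close>
      corresponds to \<open>r\<close> itself, so rows suffice as connecting lines.\<close>
    define row where "row r = {(r', c, s) \<in> cayley_square G. r' = r}" for r
    have row_line: "row r \<in> latin_lines (cayley_square G)" if "r \<in> carrier G" for r
      using that by (auto simp: latin_lines_def row_def rows_def mem_cayley_square_iff)
    have meets: "intersects (coset_square \<one> \<one> K) (row r) \<longleftrightarrow> r \<in> K"
      if "subgroup K G" "r \<in> carrier G" for K r
      using that
      by (simp add: row_def intersects_row_iff coset_square_subset rows_coset_square)
    show ?thesis
    proof (cases "i = 1")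
      case True
      have "intersects (S i) (row \<one>)"
        using True meets[OF H] subgroup.one_closed[OF H] by (simp add: S_Suc)
      moreover have "\<not> intersects (S (i - 1)) (row \<one>)"
        using True by (simp add: S0 intersects_def)
      \<comment> \<open>The previous subsquare is empty here, hence no coset square. A single entry
        is smallest because any finite set meeting the line has at least one element.\<close>
      moreover have "smallest_subsquare (cayley_square G) (row \<one>) (S (i - 1)) (S i)"
        using calculation(1) True subsquare_coset_square[OF fin _ _ H, of \<one> \<one> 0]
        by (auto simp: smallest_subsquare_def is_arg_min_def S0 S1 subsquare_def
            latin_square_def intersects_def S_Suc[of 0, symmetric])
      ultimately show ?thesis using row_line[of \<one>] by blast
    next
      case False
      \<comment> \<open>Passing from \<open>S (Suc j)\<close> to \<open>S (Suc (Suc j))\<close>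
        adjoins the generator \<open>xs ! j\<close>.\<close>
      then obtain j where j: "i = Suc (Suc j)" "j < length xs"
        using i by (cases i; cases "i - 1") auto
      let ?g = "xs ! j"
      have g: "?g \<in> carrier G" using j xs(1) by auto
      have HS: "H (Suc j) = generate G (insert ?g (H j))"
        using j g take_carrier[of j]
        by (simp add: H_def take_Suc_conv_app_nth generate_insert_generate)
      then have "?g \<in> H (Suc j)" by (auto intro: generate.incl)
      then have "intersects (S i) (row ?g)" using meets[OF H g] j by (simp add: S_Suc)
      moreover have "\<not> intersects (S (i - 1)) (row ?g)"
        using meets[OF H g] irr j by (simp add: S_Suc H_def)
      moreover have "smallest_subsquare (cayley_square G) (row ?g) (S (i - 1)) (S i)"
        using smallest_subsquare_coset_square_iff[OF fin _ _ H g meets[OF _ g]] j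
        by (simp add: S_Suc HS)
      ultimately show ?thesis using row_line[OF g] by blast
    qed
  qed
  ultimately show ?thesis unfolding connected_chain_def by blast
qed

end

section \<open>The minimum chain length from a minimum generating set\<close>

theorem theorem3p5:
  fixes G :: "('a, 'b) monoid_scheme" and A :: "'a set"
  assumes "group G" and "finite (carrier G)"
    and "A \<subseteq> carrier G" and "generate G A = carrier G"
    and "\<And>B. B \<subseteq> carrier G \<Longrightarrow> generate G B = carrier G \<Longrightarrow> card A \<le> card B"
  shows "scc (cayley_square G) = card A + 1"
proof -
  interpret group G by fact
  have "finite A" using assms(2,3) by (rule finite_subset[rotated])
  then obtain xs where xs: "set xs = A" "distinct xs" using finite_distinct_list by blast
  have len: "length xs = card A" using xs distinct_card by fastforce
  \<comment> \<open>A generator lying in the span of earlier ones could be dropped from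
    \<open>A\<close>, contradicting minimality.\<close>
  have irr: "xs ! i \<notin> generate G (set (take i xs))" if i: "i < length xs" for i
  proof
    assume redundant: "xs ! i \<in> generate G (set (take i xs))"
    let ?B = "A - {xs ! i}"
    have xi: "xs ! i \<in> A" using i xs by auto
    \<comment> \<open>Distinctness ensures that dropping \<open>xs ! i\<close> leaves the prefix
      before it intact.\<close>
    have "xs ! i \<notin> set (take i xs)"
      using xs(2) i by (auto simp: in_set_conv_nth nth_eq_iff_index_eq)
    then have "set (take i xs) \<subseteq> ?B" using xs(1) set_take_subset by fast
    then have "xs ! i \<in> generate G ?B" using redundant mono_generate by blast
    then have "A \<subseteq> generate G ?B" by (auto intro: generate.incl)
    moreover have sub: "?B \<subseteq> carrier G" using assms(3) by auto
    ultimately have "carrier G \<subseteq> generate G ?B"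
      using assms(4) generate_subgroup_incl generate_is_subgroup by metis
    then have "card A \<le> card ?B" using sub generate_incl[OF sub] assms(5) by blast
    then show False using card_Diff1_less[OF \<open>finite A\<close> xi] by simp
  qed
  show ?thesis unfolding scc_def
  proof (rule Least_equality)
    show "\<exists>S. connected_chain (cayley_square G) (card A + 1) S"
      using connected_chain_of_irredundant_generators[of xs] irr assms(2-4) xs len by simp
    show "card A + 1 \<le> \<beta>" if "\<exists>S. connected_chain (cayley_square G) \<beta> S" for \<beta>
      using that connected_chain_imp_generating_set[OF assms(2)] assms(5)
      by (metis add_le_mono1 order_trans)
  qed
qed

end
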